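(* Let $a(x;u,v)=\sum_{n\ge2}\sum_{\ell=2}^{n}\sum_{m=1}^{\ell-1}a_{n,m,\ell}\,u^m v^\ell x^n$, where $a_{n,m,\ell}$ is the number of inversion sequences of length $n$ avoiding both patterns $110$ and $102$ whose largest entry is $m$ and in which the left-most occurrence of $m$ is in position $\ell$. Then $$a(x;1,1)=\frac{x^2+x^2\sqrt{1-4x}}{(x-1)\left((3x-1)\sqrt{1-4x}-4x^2+5x-1\right)}.$$ Equivalently, for all $n\ge1$, $$|\mathbf{I}_n(110,102)|=1+\sum_{i=1}^{n-1}\binom{2i}{i-1}.$$
   Context: An inversion sequence of length $n$ is an integer sequence $e=(e_1,\dots,e_n)$ with $0\le e_i\le i-1$ for all $1\le i\le n$. A word $w_1\cdots w_n$ avoids a pattern $P=p_1\cdots p_k$ if there are no $i_1<\cdots<i_k$ such that $w_{i_1}\cdots w_{i_k}$ is order isomorphic to $P$ (equal letters of $P$ corresponding to equal entries). $\mathbf{I}_n(P_1,\dots,P_r)$ denotes the set of inversion sequences of length $n$ avoiding all of the patterns $P_1,\dots,P_r$. Series are formal power series in $x$, and $\sqrt{1-4x}$ has constant term $1$. *)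

theory Defs
  imports "HOL-Computational_Algebra.Formal_Power_Series" "HOL-Library.Sublist"
begin

definition order_isomorphic :: "'a::linorder list \<Rightarrow> 'b::linorder list \<Rightarrow> bool" where
  "order_isomorphic u p \<longleftrightarrow> length u = length p \<and>
     (\<forall>i<length p. \<forall>j<length p.
        (u ! i < u ! j \<longleftrightarrow> p ! i < p ! j) \<and> (u ! i = u ! j \<longleftrightarrow> p ! i = p ! j))"

definition avoids :: "'a::linorder list \<Rightarrow> 'b::linorder list \<Rightarrow> bool" where
  "avoids w p \<longleftrightarrow> \<not> (\<exists>s. subseq s w \<and> order_isomorphic s p)"

text \<open>Lists are indexed from 0, so the paper's bound \<open>e\<^sub>i \<le> i - 1\<close> for \<open>1 \<le> i \<le> n\<close> becomes
  \<open>e ! i \<le> i\<close> for \<open>i < n\<close>; the lower bound is built into \<^typ>\<open>nat\<close>.\<close>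

definition inversion_sequence :: "nat \<Rightarrow> nat list \<Rightarrow> bool" where
  "inversion_sequence n e \<longleftrightarrow> length e = n \<and> (\<forall>i<n. e ! i \<le> i)"

definition inv_avoiding :: "nat \<Rightarrow> nat list set \<Rightarrow> nat list set" where
  "inv_avoiding n Ps = {e. inversion_sequence n e \<and> (\<forall>p\<in>Ps. avoids e p)}"

text \<open>Positions are counted from 1: position \<open>l\<close> of \<open>e\<close> is \<open>e ! (l - 1)\<close>.\<close>

definition leftmost_occurrence :: "'a list \<Rightarrow> 'a \<Rightarrow> nat \<Rightarrow> bool" where
  "leftmost_occurrence e m l \<longleftrightarrow>
     1 \<le> l \<and> l \<le> length e \<and> e ! (l - 1) = m \<and> (\<forall>k. 1 \<le> k \<and> k < l \<longrightarrow> e ! (k - 1) \<noteq> m)"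

definition a_coeff :: "nat \<Rightarrow> nat \<Rightarrow> nat \<Rightarrow> nat" where
  "a_coeff n m l =
     card {e \<in> inv_avoiding n {[1,1,0], [1,0,2]}. Max (set e) = m \<and> leftmost_occurrence e m l}"

text \<open>A power series in \<open>x\<close> whose coefficients are polynomial expressions in \<open>u\<close> and \<open>v\<close>; these may
  be elements of any commutative semiring, in particular indeterminates of a polynomial ring.
  For \<open>n < 2\<close> the outer sum is empty, so the series starts at \<open>n = 2\<close>.\<close>

definition a_series :: "'a::comm_semiring_1 \<Rightarrow> 'a \<Rightarrow> 'a fps" where
  "a_series u v = Abs_fps (\<lambda>n. \<Sum>l=2..n. \<Sum>m=1..l-1. of_nat (a_coeff n m l) * u ^ m * v ^ l)"

definition sqrt_1_minus_4x :: "real fps" where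
  "sqrt_1_minus_4x = fps_radical root 2 (1 - 4 * fps_X)"

lemma sqrt_1_minus_4x_nth_0: "fps_nth sqrt_1_minus_4x 0 = 1"
  by (simp add: sqrt_1_minus_4x_def)

lemma sqrt_1_minus_4x_square: "sqrt_1_minus_4x ^ 2 = 1 - 4 * fps_X"
proof -
  have "fps_radical root (Suc 1) (1 - 4 * fps_X :: real fps) ^ Suc 1 = 1 - 4 * fps_X"
    by (rule iffD1[OF power_radical]) simp_all
  then show ?thesis
    by (simp add: sqrt_1_minus_4x_def numeral_2_eq_2)
qed

text \<open>The denominator of the closed form is a unit, so the division there is the genuine one.\<close>

lemma denominator_nth_0:
  "fps_nth ((fps_X - 1) * ((3 * fps_X - 1) * sqrt_1_minus_4x - 4 * fps_X ^ 2 + 5 * fps_X - 1)) 0 = 2"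
  by (simp add: sqrt_1_minus_4x_nth_0)

end

theory Submission
  imports Defs
begin

text \<open>Sequences avoiding 110 and 102 are taken apart by deleting their maximum. Let \<open>m\<close> be the
  largest entry of a nonempty avoider \<open>e\<close>, first occurring at index \<open>p\<close> (indices start at 0). What
  precedes it is weakly increasing, since a descent before \<open>m\<close> would be a 102; and if \<open>m\<close> occurs a
  second time, then every later entry is \<open>m\<close> as well (110) and all the remaining entries are weakly
  increasing (102). Hence \<open>e\<close> is recovered from the word \<open>g\<close> of its non-maximal entries and from
  \<open>p\<close>, \<open>m\<close> and its length: insert \<open>m\<close> at index \<open>p\<close> of \<open>g\<close> and put the remaining copies of \<open>m\<close> at
  the end. Being an inversion sequence amounts to the same for \<open>g\<close> together with \<open>m \<le> p\<close>.

  The weakly increasing inversion sequences are counted by the Catalan numbers. For the others, the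
  statistic \<open>slack e = p + 1 - m\<close> turns the decomposition into a recursion: the number of pairs
  \<open>(p, m)\<close> that extend \<open>g\<close> to a non-monotone sequence of slack \<open>d\<close> depends only on \<open>d\<close> and
  the slack of \<open>g\<close>, or, when \<open>g\<close> is weakly increasing, on \<open>d\<close> and its length minus its
  maximum, the \<open>room\<close> of \<open>g\<close>. This gives the linear recursion \<open>card_unsorted_slack_Suc\<close>. The distribution of the room is a
  difference of two binomial coefficients (ballot numbers, \<open>card_sorted_room_ge\<close>), and the
  recursion then telescopes to
  \<open>\<Sum>j<n. (2j - d choose j + 1)\<close> non-monotone avoiders of length \<open>n\<close> and slack \<open>d \<ge> 1\<close>
  (\<open>card_unsorted_slack\<close>). Summing over \<open>d\<close> and adding the Catalan number gives the formula for
  the cardinality.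

  For the generating function, every avoider other than the zero sequence has exactly one pair of a
  maximum \<open>m \<ge> 1\<close> and a position \<open>l \<ge> 2\<close> of its first occurrence, so that at \<open>u = v = 1\<close> the
  coefficients for \<open>n \<ge> 1\<close> are the numbers just found, less one. The closed form follows from
  \<open>\<Sum>n. (2n choose n) x^n = 1 / sqrt (1 - 4x)\<close>.\<close>

section \<open>The two patterns and the decomposition by the maximum\<close>

definition avoider :: "nat list \<Rightarrow> bool" where
  "avoider e \<longleftrightarrow> (\<forall>a b. b < a \<longrightarrow> \<not> subseq [a, a, b] e) \<and>
                 (\<forall>a b c. a < b \<longrightarrow> b < c \<longrightarrow> \<not> subseq [b, a, c] e)"

lemma order_isomorphic_triple:
  fixes x y z :: "'a :: linorder" and p q r :: "'b :: linorder"
  shows "order_isomorphic [x, y, z] [p, q, r] \<longleftrightarrow>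
    (x < y \<longleftrightarrow> p < q) \<and> (x = y \<longleftrightarrow> p = q) \<and>
    (x < z \<longleftrightarrow> p < r) \<and> (x = z \<longleftrightarrow> p = r) \<and>
    (y < z \<longleftrightarrow> q < r) \<and> (y = z \<longleftrightarrow> q = r)"
proof -
  have three: "(\<forall>i<length [p, q, r]. P i) \<longleftrightarrow> P 0 \<and> P 1 \<and> P 2" for P :: "nat \<Rightarrow> bool"
    by (auto simp: less_Suc_eq numeral_2_eq_2)
  show ?thesis
    unfolding order_isomorphic_def three by (auto simp: neq_iff)
qed

lemma order_isomorphic_tripleD:
  "order_isomorphic s [p, q, r] \<Longrightarrow> \<exists>x y z. s = [x, y, z]"
  by (auto simp: order_isomorphic_def length_Suc_conv)

lemma order_isomorphic_110:
  fixes s :: "nat list"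
  shows "order_isomorphic s [1, 1, 0 :: nat] \<longleftrightarrow> (\<exists>a b. s = [a, a, b] \<and> b < a)"
proof
  assume iso: "order_isomorphic s [1, 1, 0 :: nat]"
  then obtain x y z where "s = [x, y, z]" by (blast dest: order_isomorphic_tripleD)
  with iso show "\<exists>a b. s = [a, a, b] \<and> b < a" by (auto simp: order_isomorphic_triple)
qed (auto simp: order_isomorphic_triple)

lemma order_isomorphic_102:
  fixes s :: "nat list"
  shows "order_isomorphic s [1, 0, 2 :: nat] \<longleftrightarrow> (\<exists>a b c. s = [b, a, c] \<and> a < b \<and> b < c)"
proof
  assume iso: "order_isomorphic s [1, 0, 2 :: nat]"
  then obtain x y z where "s = [x, y, z]" by (blast dest: order_isomorphic_tripleD)
  with iso show "\<exists>a b c. s = [b, a, c] \<and> a < b \<and> b < c"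
    by (auto simp: order_isomorphic_triple)
qed (auto simp: order_isomorphic_triple)


lemma inv_avoiding_iff:
  "e \<in> inv_avoiding n {[1, 1, 0], [1, 0, 2]} \<longleftrightarrow> inversion_sequence n e \<and> avoider e"
proof -
  have "avoids e [1, 1, 0 :: nat] \<longleftrightarrow> (\<forall>a b. b < a \<longrightarrow> \<not> subseq [a, a, b] e)"
    unfolding avoids_def order_isomorphic_110 by blast
  moreover have "avoids e [1, 0, 2 :: nat] \<longleftrightarrow>
      (\<forall>a b c. a < b \<longrightarrow> b < c \<longrightarrow> \<not> subseq [b, a, c] e)"
    unfolding avoids_def order_isomorphic_102 by blast
  ultimately show ?thesis
    unfolding inv_avoiding_def avoider_def by blast
qed

lemma subseq_imp_subset: "subseq xs ys \<Longrightarrow> set xs \<subseteq> set ys"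
  by (induction rule: list_emb.induct) auto

lemma subseq_Cons_append: "subseq (x # xs) (ys @ zs) \<Longrightarrow> x \<notin> set ys \<Longrightarrow> subseq (x # xs) zs"
  by (induction ys) auto

text \<open>Used with \<open>m\<close> the maximum: if a 102 ends in the only occurrence of \<open>m\<close>, then its descent
  lies before that occurrence.\<close>
lemma subseq_snoc_append:
  assumes "subseq (xs @ [m]) (ys @ m # zs)" "m \<notin> set zs"
  shows "subseq xs ys"
proof -
  obtain us vs where split: "xs @ [m] = us @ vs" "subseq us ys" "subseq vs (m # zs)"
    using assms(1) by (blast elim: subseq_appendE)
  show ?thesis
  proof (cases vs rule: rev_cases)
    case Nil
    then show ?thesis
      using split by (metis append_Nil2 prefix_imp_subseq prefixI subseq_order.trans)
  next
    case (snoc ws w)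
    then have w: "w = m" and xs: "xs = us @ ws" using split(1) by auto
    have "ws = []"
    proof (cases ws)
      case (Cons v vs')
      then have "subseq (vs' @ [m]) zs \<or> subseq (v # vs' @ [m]) zs"
        using split(3) snoc w by (simp split: if_splits)
      then show ?thesis using assms(2) by (auto dest: subseq_imp_subset)
    qed
    then show ?thesis using xs split(2) by simp
  qed
qed

text \<open>Both patterns contain a descent, and both the decomposition of an avoider and its converse turn on
  where a descent can stand relative to the maximum; hence monotonicity is phrased through
  two-letter subsequences.\<close>
lemma sorted_iff_no_descent:
  "sorted (xs :: nat list) \<longleftrightarrow> (\<forall>a b. a < b \<longrightarrow> \<not> subseq [b, a] xs)"
proof (induction xs)
  case (Cons x xs)
  have "subseq [b, a] (x # xs) \<longleftrightarrow> (b = x \<and> a \<in> set xs) \<or> subseq [b, a] xs" for a b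
  proof (cases "b = x")
    case True
    then show ?thesis using subseq_imp_subset[of "[b, a]" xs] by (auto simp: subseq_singleton_left)
  qed simp
  then show ?case using Cons by (auto simp: not_less[symmetric])
qed simp

lemma avoider_subseq: "avoider e \<Longrightarrow> subseq g e \<Longrightarrow> avoider g"
  unfolding avoider_def by (meson subseq_order.trans)

lemma avoider_if_sorted:
  assumes "sorted e"
  shows "avoider e"
proof -
  have "\<not> subseq [b, a] e" if "a < b" for a b
    using assms that sorted_iff_no_descent by blast
  moreover have "subseq [a, b] [a, a, b]" "subseq [b, a] [b, a, c]" for a b c :: nat
    by auto
  ultimately show ?thesis
    unfolding avoider_def by (meson subseq_order.trans)
qed

text \<open>The inverse of deleting the maximum: one copy of \<open>m\<close> goes to index \<open>p\<close> of \<open>g\<close>, all others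
  to the end, where the two patterns force them.\<close>
definition with_max :: "nat list \<Rightarrow> nat \<Rightarrow> nat \<Rightarrow> nat \<Rightarrow> nat list" where
  "with_max g p m j = take p g @ m # drop p g @ replicate j m"

lemma length_with_max [simp]: "length (with_max g p m j) = Suc (length g + j)"
  by (simp add: with_max_def)

lemma set_with_max [simp]: "set (with_max g p m j) = insert m (set g)"
proof -
  have "set (with_max g p m j) = insert m (set (take p g @ drop p g))"
    unfolding with_max_def by (auto simp del: append_take_drop_id)
  then show ?thesis by simp
qed

lemma Max_with_max: "\<forall>x\<in>set g. x < m \<Longrightarrow> Max (set (with_max g p m j)) = m"
  by (auto intro!: Max_eqI)

lemma filter_with_max:
  assumes "\<forall>x\<in>set g. x < m"
  shows "filter (\<lambda>x. x \<noteq> m) (with_max g p m j) = g"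
proof -
  have "filter (\<lambda>x. x \<noteq> m) (with_max g p m j) = filter (\<lambda>x. x \<noteq> m) (take p g @ drop p g)"
    unfolding with_max_def filter_append by simp
  also have "\<dots> = g" using assms by (auto simp: filter_id_conv)
  finally show ?thesis .
qed

lemma takeWhile_with_max:
  assumes "\<forall>x\<in>set g. x < m"
  shows "takeWhile (\<lambda>x. x \<noteq> m) (with_max g p m j) = take p g"
proof -
  have "\<forall>x\<in>set (take p g). x \<noteq> m" using assms by (auto dest: in_set_takeD)
  then show ?thesis unfolding with_max_def by (subst takeWhile_append2) auto
qed

text \<open>A letter \<open>m\<close> above all of \<open>g\<close> can only act as the 2 of a 102 or as the repeated 1 of a
  110. The latter never happens, as only copies of \<open>m\<close> follow the second \<open>m\<close>. The former
  is excluded by having no descent before \<open>m\<close>: none in the first \<open>p\<close> letters of \<open>g\<close>, and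
  none in \<open>g\<close> at all if a copy of \<open>m\<close> stands at the end.\<close>
lemma avoider_with_max:
  assumes less: "\<forall>x\<in>set g. x < m"
  shows "avoider (with_max g p m j) \<longleftrightarrow>
    avoider g \<and> sorted (take p g) \<and> (0 < j \<longrightarrow> sorted g)" (is "avoider ?e \<longleftrightarrow> _")
proof
  assume e: "avoider ?e"
  have "avoider g"
    using avoider_subseq[OF e subseq_filter_left, of "\<lambda>x. x \<noteq> m"] less
    by (simp add: filter_with_max)
  moreover have "sorted (take p g)"
    unfolding sorted_iff_no_descent
  proof (intro allI impI notI)
    fix a b assume "a < b" and ba: "subseq [b, a] (take p g)"
    then have "b \<in> set g" using subseq_imp_subset[OF ba] by (auto dest: in_set_takeD)
    moreover have "subseq ([b, a] @ [m]) ?e"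
      unfolding with_max_def using ba by (intro list_emb_append_mono) auto
    ultimately show False using e \<open>a < b\<close> less by (auto simp: avoider_def)
  qed
  moreover have "sorted g" if "0 < j"
    unfolding sorted_iff_no_descent
  proof (intro allI impI notI)
    fix a b assume "a < b" and ba: "subseq [b, a] g"
    then have "b \<in> set g" using subseq_imp_subset[OF ba] by auto
    moreover have "subseq (take p g @ drop p g) (take p g @ m # drop p g)"
      unfolding subseq_append' by (rule list_emb_Cons) simp
    then have "subseq g (take p g @ m # drop p g)" by simp
    then have "subseq ([b, a] @ [m]) ((take p g @ m # drop p g) @ replicate j m)"
      using ba that
      by (intro list_emb_append_mono) (auto intro: subseq_order.trans simp: subseq_singleton_left)
    ultimately show False using e \<open>a < b\<close> less by (auto simp: avoider_def with_max_def)
  qed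
  ultimately show "avoider g \<and> sorted (take p g) \<and> (0 < j \<longrightarrow> sorted g)" by blast
next
  assume g: "avoider g \<and> sorted (take p g) \<and> (0 < j \<longrightarrow> sorted g)"
  have m: "m \<notin> set g" using less by blast
  then have mt: "m \<notin> set (take p g)" "m \<notin> set (drop p g)"
    by (auto dest: in_set_takeD in_set_dropD)
  have sub: "subseq (filter (\<lambda>x. x \<noteq> m) s) g" if "subseq s ?e" for s
    using subseq_filter[OF that, of "\<lambda>x. x \<noteq> m"] less by (simp add: filter_with_max)
  have bound: "x \<le> m" if "subseq s ?e" "x \<in> set s" for s x
    using subseq_imp_subset[OF that(1)] that(2) less by (auto simp: less_imp_le)
  show "avoider ?e"
    unfolding avoider_def
  proof (intro conjI allI impI notI)
    fix a b assume ab: "b < a" and s: "subseq [a, a, b] ?e"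
    show False
    proof (cases "a = m")
      case True
      then have "subseq [m, m, b] (m # drop p g @ replicate j m)"
        using s mt unfolding with_max_def by (blast dest: subseq_Cons_append)
      then have "subseq [m, b] (drop p g @ replicate j m)" by simp
      then have "subseq [m, b] (replicate j m)" using mt by (blast dest: subseq_Cons_append)
      then show False using ab True subseq_imp_subset[of "[m, b]" "replicate j m"] by auto
    next
      case False
      then have "subseq [a, a, b] g" using sub[OF s] bound[OF s, of a] ab by simp
      then show False using g ab by (auto simp: avoider_def)
    qed
  next
    fix a b c assume ab: "a < b" "b < c" and s: "subseq [b, a, c] ?e"
    have c: "c \<le> m" using bound[OF s] by simp
    show False
    proof (cases "c = m")
      case True
      have "subseq [b, a] g" using sub[OF s] ab c True by simp
      moreover have "subseq [b, a] (take p g)" if "j = 0"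
        using s that mt True unfolding with_max_def
        by (intro subseq_snoc_append[of "[b, a]" m _ "drop p g"]) auto
      ultimately show False using g ab unfolding sorted_iff_no_descent by blast
    next
      case False
      then have "subseq [b, a, c] g" using sub[OF s] ab c by simp
      then show False using g ab by (auto simp: avoider_def)
    qed
  qed
qed

text \<open>Cut at the first and, if there is one, at the second occurrence of the maximum. A smaller letter
  after the second one would complete a 110.\<close>
lemma avoider_decompose:
  assumes "avoider e" "e \<noteq> []"
  obtains g p m j where "e = with_max g p m j" "\<forall>x\<in>set g. x < m" "p \<le> length g"
proof -
  define m where "m = Max (set e)"
  have "m \<in> set e" and le: "\<forall>x\<in>set e. x \<le> m" using assms(2) by (auto simp: m_def)
  then obtain u w where e: "e = u @ m # w" and u: "m \<notin> set u" by (meson split_list_first)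
  show thesis
  proof (cases "m \<in> set w")
    case False
    have "e = with_max (u @ w) (length u) m 0" by (simp add: with_max_def e)
    then show thesis
      using that[of "u @ w" "length u" m 0] e u False le by (auto simp: le_less)
  next
    case True
    then obtain v z where w: "w = v @ m # z" and v: "m \<notin> set v" by (meson split_list_first)
    have "x = m" if x: "x \<in> set z" for x
    proof (rule ccontr)
      assume "x \<noteq> m"
      then have "x < m" using le x by (auto simp: e w le_less)
      moreover have "subseq [m, x] (m # z)" using x by (simp add: subseq_singleton_left)
      then have "subseq [m, m, x] e" unfolding e w
        by (intro subseq_drop_many) (simp add: subseq_drop_many)
      ultimately show False using assms(1) by (auto simp: avoider_def)
    qed
    then have "z = replicate (length z) m" by (simp add: replicate_length_same)
    then have "e = with_max (u @ v) (length u) m (Suc (length z))"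
      by (simp add: with_max_def e w)
    then show thesis
      using that[of "u @ v" "length u" m "Suc (length z)"] e w u v le by (auto simp: le_less)
  qed
qed

text \<open>The entries of \<open>g\<close> at index \<open>p\<close> or later stay below \<open>m \<le> p\<close>, so their bounds hold
  before as well as after the insertion shifts them.\<close>
lemma inversion_sequence_with_max:
  assumes less: "\<forall>x\<in>set g. x < m" and p: "p \<le> length g"
  shows "inversion_sequence n (with_max g p m j) \<longleftrightarrow>
    n = Suc (length g + j) \<and> m \<le> p \<and> inversion_sequence (length g) g" (is "?l = ?r")
proof
  have before: "with_max g p m j ! i = g ! i" if "i < p" for i
    using that p by (simp add: with_max_def nth_append)
  {
    assume l: ?l
    have "with_max g p m j ! p = m" using p by (simp add: with_max_def nth_append)
    then have mp: "m \<le> p" using l p by (auto simp: inversion_sequence_def dest: spec[of _ p])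
    have "g ! i \<le> i" if "i < length g" for i
    proof (cases "i < p")
      case True
      then show ?thesis using l before[OF True] that
        by (auto simp: inversion_sequence_def dest: spec[of _ i])
    next
      case False
      have "g ! i < m" using less that by simp
      then show ?thesis using False mp by simp
    qed
    then show ?r using l mp by (auto simp: inversion_sequence_def)
  next
    assume r: ?r
    have "with_max g p m j ! i \<le> i" if "i < n" for i
    proof (cases "i < p")
      case True
      then show ?thesis using r before[OF True] p by (auto simp: inversion_sequence_def)
    next
      case False
      have "with_max g p m j ! i \<in> set (with_max g p m j)" using that r by (intro nth_mem) simp
      then have "with_max g p m j ! i \<le> m" using less by (auto simp: less_imp_le)
      then show ?thesis using r False by simp
    qed
    then show ?l using r by (simp add: inversion_sequence_def)
  }
qed

text \<open>If \<open>p < length g\<close>, then \<open>m\<close> is followed by the smaller letter \<open>g ! p\<close>.\<close>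
lemma sorted_with_max:
  assumes less: "\<forall>x\<in>set g. x < m" and p: "p \<le> length g" and "sorted (take p g)"
  shows "sorted (with_max g p m j) \<longleftrightarrow> p = length g"
proof
  assume s: "sorted (with_max g p m j)"
  show "p = length g"
  proof (rule ccontr)
    assume "p \<noteq> length g"
    then have "p < length g" using p by simp
    then have "g ! p \<in> set (drop p g)" "g ! p < m"
      using less by (auto simp: Cons_nth_drop_Suc[symmetric])
    moreover have "m \<le> g ! p" using s calculation(1) by (auto simp: with_max_def sorted_append)
    ultimately show False by simp
  qed
next
  assume "p = length g"
  then show "sorted (with_max g p m j)"
    using assms by (auto simp: with_max_def sorted_append less_imp_le)
qed

definition unsorted_avoiders :: "nat \<Rightarrow> nat list set" where
  "unsorted_avoiders n = {e. inversion_sequence n e \<and> avoider e \<and> \<not> sorted e}"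

definition sorted_invseqs :: "nat \<Rightarrow> nat list set" where
  "sorted_invseqs n = {e. inversion_sequence n e \<and> sorted e}"

definition max_pos :: "nat list \<Rightarrow> nat" where
  "max_pos e = length (takeWhile (\<lambda>x. x \<noteq> Max (set e)) e)"

text \<open>The data that remain after the maximum of a non-monotone avoider of length \<open>n + 1\<close> is
  deleted. The word \<open>g\<close> is shorter than \<open>n\<close> precisely when the maximum was repeated, and then
  \<open>g\<close> is weakly increasing. In all cases \<open>p < length g\<close>, as otherwise the original word
  would be weakly increasing.\<close>
definition peel_triples :: "nat \<Rightarrow> (nat list \<times> nat \<times> nat) set" where
  "peel_triples n = {(g, p, m). length g \<le> n \<and> inversion_sequence (length g) g \<and> avoider g \<and>
     (\<forall>x\<in>set g. x < m) \<and> m \<le> p \<and> p < length g \<and> sorted (take p g) \<and>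
     (length g < n \<longrightarrow> sorted g)}"

lemma max_pos_with_max:
  "\<forall>x\<in>set g. x < m \<Longrightarrow> p \<le> length g \<Longrightarrow> max_pos (with_max g p m j) = p"
  unfolding max_pos_def by (simp only: Max_with_max takeWhile_with_max) simp

lemma bij_betw_with_max:
  "bij_betw (\<lambda>(g, p, m). with_max g p m (n - length g)) (peel_triples n) (unsorted_avoiders (Suc n))"
proof (rule bij_betw_imageI)
  define peel where "peel e = (filter (\<lambda>x. x \<noteq> Max (set e)) e, max_pos e, Max (set e))"
    for e :: "nat list"
  show "inj_on (\<lambda>(g, p, m). with_max g p m (n - length g)) (peel_triples n)"
  proof (rule inj_on_inverseI[where g = peel])
    fix t assume "t \<in> peel_triples n"
    then show "peel (case t of (g, p, m) \<Rightarrow> with_max g p m (n - length g)) = t"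
      unfolding peel_def peel_triples_def
      by (clarsimp simp del: set_with_max
            simp: Max_with_max filter_with_max max_pos_with_max)
  qed
  show "(\<lambda>(g, p, m). with_max g p m (n - length g)) ` peel_triples n = unsorted_avoiders (Suc n)"
  proof (intro equalityI subsetI)
    fix e assume "e \<in> (\<lambda>(g, p, m). with_max g p m (n - length g)) ` peel_triples n"
    then show "e \<in> unsorted_avoiders (Suc n)"
      by (auto simp: unsorted_avoiders_def peel_triples_def inversion_sequence_with_max
            avoider_with_max sorted_with_max)
  next
    fix e assume e: "e \<in> unsorted_avoiders (Suc n)"
    then have "avoider e" "e \<noteq> []" by (auto simp: unsorted_avoiders_def inversion_sequence_def)
    then obtain g p m j where d: "e = with_max g p m j" "\<forall>x\<in>set g. x < m" "p \<le> length g"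
      by (rule avoider_decompose)
    have "n = length g + j"
      using e d by (simp add: unsorted_avoiders_def inversion_sequence_with_max)
    then have "(g, p, m) \<in> peel_triples n" "e = with_max g p m (n - length g)"
      using e d by (auto simp: unsorted_avoiders_def peel_triples_def inversion_sequence_with_max
            avoider_with_max sorted_with_max le_less)
    then show "e \<in> (\<lambda>(g, p, m). with_max g p m (n - length g)) ` peel_triples n"
      by force
  qed
qed

section \<open>A recursion for the non-monotone avoiders\<close>

text \<open>For a non-monotone avoider with maximum \<open>m\<close> at index \<open>p\<close>, the longest weakly increasing
  prefix has length \<open>p + 1\<close>, so a new maximum may be inserted at any index up to \<open>p + 1\<close>.
  It must exceed \<open>m\<close> and not exceed its index: the slack counts the indices that leave a choice.\<close>
definition slack :: "nat list \<Rightarrow> nat" where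
  "slack e = Suc (max_pos e) - Max (set e)"

text \<open>The analogue of the slack for weakly increasing \<open>e\<close>, where a new maximum may go anywhere.\<close>
definition room :: "nat list \<Rightarrow> nat" where
  "room e = length e - Max (set e)"

lemma finite_inversion_sequences: "finite {e. inversion_sequence n e}"
proof (rule finite_subset)
  show "{e. inversion_sequence n e} \<subseteq> {xs. set xs \<subseteq> {..n} \<and> length xs = n}"
    by (fastforce simp: inversion_sequence_def in_set_conv_nth)
qed (simp add: finite_lists_length_eq)

lemma finite_unsorted_avoiders [simp]: "finite (unsorted_avoiders n)"
  by (rule finite_subset[OF _ finite_inversion_sequences[of n]]) (auto simp: unsorted_avoiders_def)

lemma finite_sorted_invseqs [simp]: "finite (sorted_invseqs n)"
  by (rule finite_subset[OF _ finite_inversion_sequences[of n]]) (auto simp: sorted_invseqs_def)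

lemma unsorted_decompose:
  assumes "e \<in> unsorted_avoiders n"
  obtains g p m j where "e = with_max g p m j" "\<forall>x\<in>set g. x < m" "m \<le> p" "p < length g"
    "sorted (take p g)" "max_pos e = p" "Max (set e) = m" "n = Suc (length g + j)"
proof -
  have e: "inversion_sequence n e" "avoider e" "\<not> sorted e"
    using assms by (auto simp: unsorted_avoiders_def)
  then have "e \<noteq> []" by auto
  with \<open>avoider e\<close> obtain g p m j
    where d: "e = with_max g p m j" "\<forall>x\<in>set g. x < m" "p \<le> length g"
    by (rule avoider_decompose)
  moreover have "sorted (take p g)" using e(2) d by (simp add: avoider_with_max)
  moreover from this have "p \<noteq> length g" using e(3) d sorted_with_max by blast
  moreover have "m \<le> p" "n = Suc (length g + j)"
    using e(1) d by (simp_all add: inversion_sequence_with_max)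
  moreover have "max_pos e = p" "Max (set e) = m"
    using d max_pos_with_max Max_with_max by blast+
  ultimately show thesis using that by (metis le_neq_implies_less)
qed

lemma sorted_take_unsorted_avoider:
  assumes e: "e \<in> unsorted_avoiders n"
  shows "p < n \<and> sorted (take p e) \<longleftrightarrow> p \<le> Suc (max_pos e)"
proof -
  obtain g q m j where d: "e = with_max g q m j" "\<forall>x\<in>set g. x < m" "q < length g"
    "sorted (take q g)" "max_pos e = q" "n = Suc (length g + j)"
    using e by (rule unsorted_decompose)
  have split: "e = (take q g @ [m]) @ drop q g @ replicate j m" by (simp add: d(1) with_max_def)
  show ?thesis
  proof
    assume p: "p < n \<and> sorted (take p e)"
    show "p \<le> Suc (max_pos e)"
    proof (rule ccontr)
      assume "\<not> p \<le> Suc (max_pos e)"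
      then have q: "Suc q < p" using d(5) by simp
      have "take p e ! q \<le> take p e ! Suc q"
        using p q d by (intro sorted_nth_mono) auto
      then have "e ! q \<le> e ! Suc q" using q by simp
      moreover have "e ! q = m" "e ! Suc q = g ! q"
        using d(3) by (simp_all add: split nth_append)
      moreover have "g ! q < m" using d by simp
      ultimately show False by simp
    qed
  next
    assume "p \<le> Suc (max_pos e)"
    then have "p \<le> length (take q g @ [m])" using d by simp
    moreover have "take p (xs @ ys) = take p xs" if "p \<le> length xs" for xs ys :: "nat list"
      using that by simp
    ultimately have "take p e = take p (take q g @ [m])" unfolding split by blast
    moreover have "sorted (take q g @ [m])"
      using d by (auto simp: sorted_append less_imp_le dest: in_set_takeD)
    ultimately have "sorted (take p e)" by (simp only: sorted_wrt_take)
    then show "p < n \<and> sorted (take p e)"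
      using d \<open>p \<le> Suc (max_pos e)\<close> by simp
  qed
qed

text \<open>Fixing the slack \<open>d\<close> of the result determines \<open>m\<close> from \<open>p\<close>, and \<open>p\<close> ranges over
  an interval.\<close>
lemma card_peak_choices:
  assumes "0 < d"
  shows "card {(p, m). M < m \<and> m \<le> p \<and> p < b \<and> Suc p - m = d} = b - (M + d)"
proof -
  have "{(p, m). M < m \<and> m \<le> p \<and> p < b \<and> Suc p - m = d} = (\<lambda>p. (p, Suc p - d)) ` {M + d..<b}"
    using assms by (auto simp: image_iff)
  then show ?thesis by (simp add: card_image inj_on_def)
qed

lemma card_triples_unsorted:
  assumes g: "g \<in> unsorted_avoiders n" and d: "0 < d"
  shows "card {(p, m). (g, p, m) \<in> peel_triples n \<and> Suc p - m = d} = Suc (slack g) - d"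
proof -
  obtain h q M j where "max_pos g = q" "Max (set g) = M" "M \<le> q"
    using g by (rule unsorted_decompose) blast
  note q = this
  have g': "length g = n" "inversion_sequence n g" "avoider g" "g \<noteq> []"
    using g by (auto simp: unsorted_avoiders_def inversion_sequence_def)
  have "(g, p, m) \<in> peel_triples n \<longleftrightarrow> M < m \<and> m \<le> p \<and> p < Suc (Suc q)" for p m
    using sorted_take_unsorted_avoider[OF g, of p] g' q by (auto simp: peel_triples_def)
  then have "card {(p, m). (g, p, m) \<in> peel_triples n \<and> Suc p - m = d} = Suc (Suc q) - (M + d)"
    using card_peak_choices[OF d, of M "Suc (Suc q)"] by (simp add: conj_assoc)
  then show ?thesis using q by (simp add: slack_def)
qed

lemma card_triples_sorted:
  assumes g: "g \<in> sorted_invseqs q" and "q \<le> n" and d: "0 < d"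
  shows "card {(p, m). (g, p, m) \<in> peel_triples n \<and> Suc p - m = d} = room g - d"
proof (cases "g = []")
  case False
  have g': "length g = q" "inversion_sequence q g" "sorted g" "avoider g"
    using g by (auto simp: sorted_invseqs_def inversion_sequence_def avoider_if_sorted)
  have "(g, p, m) \<in> peel_triples n \<longleftrightarrow> Max (set g) < m \<and> m \<le> p \<and> p < q" for p m
    using g' False \<open>q \<le> n\<close> by (auto simp: peel_triples_def sorted_wrt_take)
  then show ?thesis
    using card_peak_choices[OF d, of "Max (set g)" q] g'(1) by (simp add: conj_assoc room_def)
qed (simp add: peel_triples_def room_def)

text \<open>The sum over \<open>unsorted_avoiders n\<close> comes from deleting a maximum that occurs once, with a
  non-monotone rest. In the double sum the rest is weakly increasing, of length \<open>q\<close>, and the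
  maximum occurred \<open>n + 1 - q\<close> times.\<close>
lemma card_unsorted_slack_Suc:
  assumes d: "0 < d"
  shows "card {e \<in> unsorted_avoiders (Suc n). slack e = d} =
    (\<Sum>g\<in>unsorted_avoiders n. Suc (slack g) - d) +
    (\<Sum>q\<le>n. \<Sum>g\<in>sorted_invseqs q. room g - d)"
proof -
  define F where "F g = {(p, m). (g, p, m) \<in> peel_triples n \<and> Suc p - m = d}" for g
  define S where "S = (\<Union>q\<le>n. sorted_invseqs q)"
  have fin: "finite (F g)" for g
  proof (rule finite_subset)
    show "F g \<subseteq> {..length g} \<times> {..length g}" by (auto simp: F_def peel_triples_def)
  qed simp
  have "bij_betw (\<lambda>(g, p, m). with_max g p m (n - length g))
      {t \<in> peel_triples n. case t of (g, p, m) \<Rightarrow> Suc p - m = d}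
      {e \<in> unsorted_avoiders (Suc n). slack e = d}"
  proof (rule bij_betw_Collect[OF bij_betw_with_max])
    fix t assume "t \<in> peel_triples n"
    then show "(slack (case t of (g, p, m) \<Rightarrow> with_max g p m (n - length g)) = d) \<longleftrightarrow>
        (case t of (g, p, m) \<Rightarrow> Suc p - m = d)"
      by (auto simp: slack_def peel_triples_def max_pos_with_max Max_with_max simp del: set_with_max)
  qed
  then have "card {e \<in> unsorted_avoiders (Suc n). slack e = d} =
      card {t \<in> peel_triples n. case t of (g, p, m) \<Rightarrow> Suc p - m = d}"
    by (rule bij_betw_same_card[symmetric])
  also have "{t \<in> peel_triples n. case t of (g, p, m) \<Rightarrow> Suc p - m = d} =
      Sigma (unsorted_avoiders n \<union> S) F"
    by (auto simp: F_def S_def peel_triples_def unsorted_avoiders_def sorted_invseqs_def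
          inversion_sequence_def avoider_if_sorted)
  also have "card \<dots> = (\<Sum>g\<in>unsorted_avoiders n \<union> S. card (F g))"
    by (rule card_SigmaI) (simp_all add: S_def fin)
  also have "\<dots> = (\<Sum>g\<in>unsorted_avoiders n. card (F g)) + (\<Sum>g\<in>S. card (F g))"
    by (rule sum.union_disjoint)
      (simp, simp add: S_def, auto simp: S_def unsorted_avoiders_def sorted_invseqs_def)
  also have "(\<Sum>g\<in>S. card (F g)) = (\<Sum>q\<le>n. \<Sum>g\<in>sorted_invseqs q. card (F g))"
    unfolding S_def
    by (rule sum.UNION_disjoint)
      (simp, simp, auto simp: sorted_invseqs_def inversion_sequence_def)
  finally show ?thesis
    using d by (simp add: F_def card_triples_unsorted card_triples_sorted)
qed

section \<open>Solving the recursion\<close>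

text \<open>Sums of truncated differences become tail counts, and tail counts become exact counts, after taking
  one difference in \<open>d\<close>; this is how the closed forms of the sums and tail counts below
  are verified.\<close>
lemma sum_truncated_diff_Suc:
  assumes "finite S"
  shows "(\<Sum>x\<in>S. r x - d) = (\<Sum>x\<in>S. r x - Suc d) + card {x \<in> S. Suc d \<le> r x}"
proof -
  have "(\<Sum>x\<in>S. r x - d) = (\<Sum>x\<in>S. (r x - Suc d) + (if Suc d \<le> r x then 1 else 0))"
    by (rule sum.cong) auto
  then show ?thesis using assms by (simp add: sum.distrib sum.inter_filter[symmetric])
qed

lemma card_le_eq_Suc:
  fixes r :: "'a \<Rightarrow> nat"
  assumes "finite S"
  shows "card {x \<in> S. d \<le> r x} = card {x \<in> S. r x = d} + card {x \<in> S. Suc d \<le> r x}"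
proof -
  have "{x \<in> S. d \<le> r x} = {x \<in> S. r x = d} \<union> {x \<in> S. Suc d \<le> r x}" by auto
  moreover have "{x \<in> S. r x = d} \<inter> {x \<in> S. Suc d \<le> r x} = {}" by auto
  ultimately show ?thesis using assms by (simp add: card_Un_disjoint)
qed

lemma backward_difference_eqI:
  fixes f g :: "nat \<Rightarrow> int"
  assumes "\<And>d. a \<le> d \<Longrightarrow> f d - f (Suc d) = g d - g (Suc d)"
    and "\<And>d. b \<le> d \<Longrightarrow> f d = g d" and "a \<le> d"
  shows "f d = g d"
  using assms(3)
proof (induction "b - d" arbitrary: d)
  case (Suc k)
  then have "f (Suc d) = g (Suc d)" by simp
  then show ?case using assms(1)[OF Suc.prems] by simp
qed (simp add: assms(2))

text \<open>Truncated subtraction does no harm here: for \<open>d > m\<close> both sides vanish, which is where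
  \<open>0 < k\<close> enters. It allows the closed forms to be used for every \<open>d\<close>.\<close>
lemma truncated_Pascal:
  assumes "0 < k"
  shows "Suc m - d choose Suc k = (m - d choose k) + (m - d choose Suc k)"
proof (cases "d \<le> m")
  case False
  then show ?thesis using assms by simp
qed (simp add: Suc_diff_le)

lemma Max_less_length:
  assumes "inversion_sequence n e" "e \<noteq> []"
  shows "Max (set e) < n"
proof -
  have "\<forall>x\<in>set e. x < n"
    using assms(1) by (fastforce simp: inversion_sequence_def in_set_conv_nth)
  then show ?thesis using assms(2) by simp
qed

lemma inversion_sequence_snoc:
  "inversion_sequence (Suc n) (f @ [x]) \<longleftrightarrow> inversion_sequence n f \<and> x \<le> n"
  by (auto simp: inversion_sequence_def nth_append less_Suc_eq)

lemma sorted_snoc_iff: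
  "f \<noteq> [] \<Longrightarrow> sorted (f @ [x]) \<longleftrightarrow> sorted f \<and> Max (set f) \<le> x" for x :: nat
  by (auto simp: sorted_append)

lemma Max_snoc:
  "sorted (f @ [x]) \<Longrightarrow> Max (set (f @ [x])) = x" for x :: nat
  by (auto simp: sorted_append intro!: Max_eqI)

text \<open>Deleting the last entry: room \<open>k + 1\<close> forces that entry to be \<open>q - k\<close>, and it may follow
  \<open>f\<close> exactly if the maximum of \<open>f\<close> is at most \<open>q - k\<close>.\<close>
lemma card_sorted_room_Suc:
  assumes "0 < q"
  shows "card {f \<in> sorted_invseqs (Suc q). room f = Suc k} = card {f \<in> sorted_invseqs q. k \<le> room f}"
proof (cases "k \<le> q")
  case True
  have "bij_betw (\<lambda>f. f @ [q - k]) {f \<in> sorted_invseqs q. k \<le> room f}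
      {f \<in> sorted_invseqs (Suc q). room f = Suc k}"
  proof (rule bij_betw_imageI)
    show "(\<lambda>f. f @ [q - k]) ` {f \<in> sorted_invseqs q. k \<le> room f} =
        {f \<in> sorted_invseqs (Suc q). room f = Suc k}"
    proof (intro equalityI subsetI)
      fix e assume "e \<in> (\<lambda>f. f @ [q - k]) ` {f \<in> sorted_invseqs q. k \<le> room f}"
      then obtain f where e: "e = f @ [q - k]" and f: "inversion_sequence q f" "sorted f" "k \<le> room f"
        by (auto simp: sorted_invseqs_def)
      have len: "length f = q" "f \<noteq> []" using f assms by (auto simp: inversion_sequence_def)
      then have "Max (set f) \<le> q - k"
        using f(3) Max_less_length[OF f(1) len(2)] unfolding room_def len(1) by linarith
      then have "sorted e" using f(2) unfolding e sorted_snoc_iff[OF len(2)] by blast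
      moreover have "inversion_sequence (Suc q) e" using f e by (simp add: inversion_sequence_snoc)
      moreover have "room e = Suc k"
        using Max_snoc[of f "q - k"] \<open>sorted e\<close> len True unfolding e room_def by simp
      ultimately show "e \<in> {f \<in> sorted_invseqs (Suc q). room f = Suc k}"
        by (simp add: sorted_invseqs_def)
    next
      fix e assume "e \<in> {f \<in> sorted_invseqs (Suc q). room f = Suc k}"
      then have e: "inversion_sequence (Suc q) e" "sorted e" "room e = Suc k"
        by (auto simp: sorted_invseqs_def)
      then obtain f x where fx: "e = f @ [x]"
        by (cases e rule: rev_cases) (auto simp: inversion_sequence_def)
      have f: "inversion_sequence q f" "x \<le> q" using e fx by (simp_all add: inversion_sequence_snoc)
      then have len: "length f = q" "f \<noteq> []" using assms by (auto simp: inversion_sequence_def)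
      have "Suc q - x = Suc k" using e Max_snoc[of f x] len unfolding fx room_def by simp
      then have x: "x = q - k" using f True by simp
      moreover have "sorted f \<and> Max (set f) \<le> x"
        using e(2) unfolding fx sorted_snoc_iff[OF len(2)] .
      moreover from calculation have "k \<le> room f"
        using True unfolding room_def len(1) by linarith
      ultimately have "f \<in> {f \<in> sorted_invseqs q. k \<le> room f}"
        using f by (simp add: sorted_invseqs_def)
      then show "e \<in> (\<lambda>f. f @ [q - k]) ` {f \<in> sorted_invseqs q. k \<le> room f}"
        using fx x by blast
    qed
  qed (simp add: inj_on_def)
  then show ?thesis by (rule bij_betw_same_card[symmetric])
next
  case False
  then have "{f \<in> sorted_invseqs (Suc q). room f = Suc k} = {}"
    "{f \<in> sorted_invseqs q. k \<le> room f} = {}"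
    by (auto simp: sorted_invseqs_def inversion_sequence_def room_def)
  then show ?thesis by (simp only:)
qed

text \<open>Writing \<open>N q k\<close> for the left-hand side, the previous lemma says
  \<open>N (q + 1) (k + 1) = N (q + 1) (k + 2) + N q k\<close>, the recursion of the ballot numbers, which
  the right-hand side satisfies by Pascal's rule. For \<open>k = 0\<close> the room is at least 1, and the
  symmetry of the middle binomial coefficients gives the same value as for \<open>k = 1\<close>.\<close>
lemma card_sorted_room_ge:
  assumes "0 < q"
  shows "int (card {f \<in> sorted_invseqs q. k \<le> room f}) =
    int (2 * q - k choose q) - int (2 * q - k choose Suc q)"
  using assms
proof (induction q arbitrary: k rule: nat_induct_non_zero)
  case 1
  have singleton: "inversion_sequence 1 e \<longleftrightarrow> e = [0]" for e
  proof
    assume e: "inversion_sequence 1 e"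
    then have "length e = 1 \<and> e ! 0 \<le> 0" unfolding inversion_sequence_def by blast
    then show "e = [0]" by (cases e) auto
  next
    assume "e = [0]"
    then show "inversion_sequence 1 e"
      using inversion_sequence_snoc[of 0 "[]" 0] by (simp add: inversion_sequence_def[of 0])
  qed
  have "sorted_invseqs 1 = {[0]}" unfolding sorted_invseqs_def singleton by force
  moreover have "room [0] = 1" by (simp add: room_def)
  ultimately have "{f \<in> sorted_invseqs 1. k \<le> room f} = (if k \<le> 1 then {[0]} else {})"
    unfolding \<open>sorted_invseqs 1 = {[0]}\<close> by auto
  then have card: "int (card {f \<in> sorted_invseqs 1. k \<le> room f}) = (if k \<le> 1 then 1 else 0)"
    by (simp only: if_distrib[of card] if_distrib[of int]) simp
  have "k = 0 \<or> k = 1 \<or> 2 \<le> k" by linarith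
  then have "int (2 * 1 - k choose 1) - int (2 * 1 - k choose Suc 1) = (if k \<le> 1 then 1 else 0)"
  proof (elim disjE)
    assume "k = 0"
    moreover have "Suc 1 = (2 :: nat)" by (rule Suc_1)
    ultimately show ?thesis by (simp only: mult_1_right diff_zero binomial_n_n) simp
  next
    assume "k = 1"
    then show ?thesis by simp
  next
    assume "2 \<le> k"
    then show ?thesis by simp
  qed
  with card show ?case by (simp only:)
next
  case (Suc q)
  define f g where "f k = int (card {f \<in> sorted_invseqs (Suc q). k \<le> room f})"
    and "g k = int (2 * Suc q - k choose Suc q) - int (2 * Suc q - k choose Suc (Suc q))" for k
  have positive: "f k = g k" if "1 \<le> k" for k
  proof (rule backward_difference_eqI[where f = f and g = g, OF _ _ that])
    fix d :: nat assume "1 \<le> d"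
    then obtain d' where d: "d = Suc d'" by (cases d) auto
    have "f d - f (Suc d) = int (card {f \<in> sorted_invseqs q. d' \<le> room f})"
      using card_le_eq_Suc[of "sorted_invseqs (Suc q)" d room] card_sorted_room_Suc[OF Suc.hyps(1), of d']
      unfolding f_def d by simp
    also have "\<dots> = int (2 * q - d' choose q) - int (2 * q - d' choose Suc q)" by (rule Suc.IH)
    also have "\<dots> = g d - g (Suc d)"
    proof -
      have "2 * Suc q - d = Suc (2 * q) - d'" "2 * Suc q - Suc d = 2 * q - d'" by (simp_all add: d)
      then show ?thesis
        unfolding g_def by (simp only: truncated_Pascal[OF Suc.hyps(1)] truncated_Pascal[OF zero_less_Suc]
              of_nat_add)
    qed
    finally show "f d - f (Suc d) = g d - g (Suc d)" .
  next
    fix d assume "Suc (Suc q) + Suc q \<le> d"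
    then have "{f \<in> sorted_invseqs (Suc q). d \<le> room f} = {}"
      by (auto simp: sorted_invseqs_def inversion_sequence_def room_def)
    then show "f d = g d" using \<open>Suc (Suc q) + Suc q \<le> d\<close> by (simp add: f_def g_def)
  qed
  show ?case
  proof (cases "k = 0")
    case True
    have "1 \<le> room e" if "e \<in> sorted_invseqs (Suc q)" for e
    proof -
      have e: "inversion_sequence (Suc q) e" "length e = Suc q"
        using that by (simp_all add: sorted_invseqs_def inversion_sequence_def)
      then have "Max (set e) < Suc q" by (intro Max_less_length) auto
      then show ?thesis unfolding room_def e(2) by linarith
    qed
    then have "{e \<in> sorted_invseqs (Suc q). 0 \<le> room e} = {e \<in> sorted_invseqs (Suc q). 1 \<le> room e}"
      by blast
    then have "f 0 = f 1" by (simp only: f_def)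
    moreover have "g 0 = g 1"
      using binomial_symmetric[of q "Suc (2 * q)"] by (simp add: g_def)
    ultimately show ?thesis using positive[of 1] True by (simp add: f_def g_def)
  next
    case False
    then show ?thesis using positive[of k] by (simp add: f_def g_def)
  qed
qed

lemma sum_sorted_room:
  "int (\<Sum>f\<in>sorted_invseqs q. room f - d) =
    int (2 * q - d choose Suc q) - int (2 * q - d choose Suc (Suc q))"
proof (cases "q = 0")
  case True
  then show ?thesis by (auto simp: sorted_invseqs_def inversion_sequence_def room_def)
next
  case False
  define f g where "f d = int (\<Sum>f\<in>sorted_invseqs q. room f - d)"
    and "g d = int (2 * q - d choose Suc q) - int (2 * q - d choose Suc (Suc q))" for d
  have "f d = g d"
  proof (rule backward_difference_eqI[where f = f and g = g and a = 0])
    fix d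
    have "f d - f (Suc d) = int (card {f \<in> sorted_invseqs q. Suc d \<le> room f})"
      unfolding f_def using sum_truncated_diff_Suc[of "sorted_invseqs q" room d] by simp
    also have "\<dots> = int (2 * q - Suc d choose q) - int (2 * q - Suc d choose Suc q)"
      using False by (simp only: card_sorted_room_ge)
    also have "\<dots> = g d - g (Suc d)"
    proof -
      have "2 * q - d = Suc (2 * q - 1) - d" "2 * q - Suc d = 2 * q - 1 - d" using False by simp_all
      moreover note truncated_Pascal[of q "2 * q - 1" d] truncated_Pascal[of "Suc q" "2 * q - 1" d]
      ultimately show ?thesis unfolding g_def using False by simp
    qed
    finally show "f d - f (Suc d) = g d - g (Suc d)" .
  next
    fix d assume "2 * q \<le> d"
    moreover from this have "room f - d = 0" if "f \<in> sorted_invseqs q" for f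
      using that by (auto simp: sorted_invseqs_def inversion_sequence_def room_def)
    ultimately show "f d = g d" by (simp add: f_def g_def)
  qed simp
  then show ?thesis by (simp add: f_def g_def)
qed

lemma slack_le: "e \<in> unsorted_avoiders n \<Longrightarrow> slack e \<le> Suc n"
  using length_takeWhile_le[of "\<lambda>x. x \<noteq> Max (set e)" e]
  by (simp add: slack_def max_pos_def unsorted_avoiders_def inversion_sequence_def)

text \<open>This and the next lemma sum the distribution of the slack once and twice over its tail. Each
  summation raises the upper and the lower index of the binomial coefficients by one (hockey stick).\<close>
lemma card_unsorted_slack_ge:
  assumes eq: "\<And>d. 0 < d \<Longrightarrow>
      card {e \<in> unsorted_avoiders n. slack e = d} = (\<Sum>j<n. 2 * j - d choose Suc j)"
    and d: "0 < d"
  shows "int (card {e \<in> unsorted_avoiders n. d \<le> slack e}) =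
      int (\<Sum>j<n. Suc (2 * j) - d choose Suc (Suc j))"
proof -
  define f g where "f d = int (card {e \<in> unsorted_avoiders n. d \<le> slack e})"
    and "g d = int (\<Sum>j<n. Suc (2 * j) - d choose Suc (Suc j))" for d
  have "f d = g d"
  proof (rule backward_difference_eqI[where f = f and g = g and a = 1])
    fix d :: nat assume d: "1 \<le> d"
    have "f d - f (Suc d) = int (\<Sum>j<n. 2 * j - d choose Suc j)"
      using card_le_eq_Suc[of "unsorted_avoiders n" d slack] eq[of d] d by (simp add: f_def)
    also have "\<dots> = g d - g (Suc d)"
      unfolding g_def using truncated_Pascal[of "Suc _" "2 * _" d]
      by (simp add: sum.distrib)
    finally show "f d - f (Suc d) = g d - g (Suc d)" .
  next
    fix d assume d: "Suc (Suc (2 * n)) \<le> d"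
    then have "{e \<in> unsorted_avoiders n. d \<le> slack e} = {}" using slack_le[of _ n] by fastforce
    then have "f d = 0" by (simp add: f_def)
    moreover have "g d = 0" using d unfolding g_def of_nat_sum by (intro sum.neutral) auto
    ultimately show "f d = g d" by simp
  qed (use d in simp)
  then show ?thesis by (simp add: f_def g_def)
qed

lemma sum_unsorted_slack:
  assumes eq: "\<And>d. 0 < d \<Longrightarrow>
      card {e \<in> unsorted_avoiders n. slack e = d} = (\<Sum>j<n. 2 * j - d choose Suc j)"
    and d: "0 < d"
  shows "int (\<Sum>e\<in>unsorted_avoiders n. Suc (slack e) - d) =
      int (\<Sum>j<n. 2 * Suc j - d choose Suc (Suc (Suc j)))"
proof -
  define f g where "f d = int (\<Sum>e\<in>unsorted_avoiders n. Suc (slack e) - d)"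
    and "g d = int (\<Sum>j<n. 2 * Suc j - d choose Suc (Suc (Suc j)))" for d
  have "f d = g d"
  proof (rule backward_difference_eqI[where f = f and g = g and a = 1])
    fix d :: nat assume d: "1 \<le> d"
    have "f d - f (Suc d) = int (card {e \<in> unsorted_avoiders n. d \<le> slack e})"
      unfolding f_def
      using sum_truncated_diff_Suc[of "unsorted_avoiders n" "\<lambda>e. Suc (slack e)" d] by simp
    also have "\<dots> = int (\<Sum>j<n. Suc (2 * j) - d choose Suc (Suc j))"
      using card_unsorted_slack_ge[OF eq] d by simp
    also have "\<dots> = g d - g (Suc d)"
      unfolding g_def using truncated_Pascal[of "Suc (Suc _)" "Suc (2 * _)" d]
      by (simp add: sum.distrib)
    finally show "f d - f (Suc d) = g d - g (Suc d)" .
  next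
    fix d assume d: "Suc (Suc (2 * n)) \<le> d"
    then have "f d = 0" using slack_le[of _ n] unfolding f_def of_nat_sum
      by (intro sum.neutral) fastforce
    moreover have "g d = 0" using d unfolding g_def of_nat_sum by (intro sum.neutral) auto
    ultimately show "f d = g d" by simp
  qed (use d in simp)
  then show ?thesis by (simp add: f_def g_def)
qed

text \<open>In the recursion the twice-summed terms \<open>(2j + 2 - d choose j + 3)\<close> cancel against the
  subtracted halves of the ballot numbers; the other halves are the claimed sum for \<open>n + 1\<close>.\<close>
lemma card_unsorted_slack:
  "0 < d \<Longrightarrow> card {e \<in> unsorted_avoiders n. slack e = d} = (\<Sum>j<n. 2 * j - d choose Suc j)"
proof (induction n arbitrary: d)
  case 0
  have "unsorted_avoiders 0 = {}" by (auto simp: unsorted_avoiders_def inversion_sequence_def)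
  then show ?case by simp
next
  case (Suc n)
  have "int (card {e \<in> unsorted_avoiders (Suc n). slack e = d}) =
      int (\<Sum>j<n. 2 * Suc j - d choose Suc (Suc (Suc j))) +
      (\<Sum>q\<le>n. int (2 * q - d choose Suc q) - int (2 * q - d choose Suc (Suc q)))"
    using sum_unsorted_slack[OF Suc.IH Suc.prems]
    unfolding card_unsorted_slack_Suc[OF Suc.prems] of_nat_add
      of_nat_sum[of _ "{..n}"] sum_sorted_room by simp
  also have "\<dots> = int (\<Sum>q\<le>n. 2 * q - d choose Suc q)"
  proof -
    have "(\<Sum>q\<le>n. 2 * q - d choose Suc (Suc q)) = (\<Sum>j<n. 2 * Suc j - d choose Suc (Suc (Suc j)))"
      by (simp add: sum.atMost_shift)
    then show ?thesis unfolding sum_subtractf of_nat_sum[symmetric] by simp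
  qed
  finally show ?case by (simp only: of_nat_eq_iff lessThan_Suc_atMost)
qed

lemma card_unsorted_avoiders:
  "card (unsorted_avoiders n) = (\<Sum>j<n. 2 * j choose Suc (Suc j))"
proof -
  have "1 \<le> slack e" if "e \<in> unsorted_avoiders n" for e
    using that by (rule unsorted_decompose) (simp add: slack_def)
  then have "{e \<in> unsorted_avoiders n. 1 \<le> slack e} = unsorted_avoiders n" by auto
  moreover have "int (card {e \<in> unsorted_avoiders n. 1 \<le> slack e}) =
      int (\<Sum>j<n. Suc (2 * j) - 1 choose Suc (Suc j))"
    using card_unsorted_slack zero_less_one by (rule card_unsorted_slack_ge)
  ultimately show ?thesis unfolding of_nat_eq_iff diff_Suc_1 by metis
qed

lemma card_sorted_invseqs:
  assumes "0 < n"
  shows "int (card (sorted_invseqs n)) = int (2 * n choose n) - int (2 * n choose Suc n)"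
  using card_sorted_room_ge[OF assms, of 0] by simp

text \<open>By Pascal's rule the Catalan number grows by \<open>(2n choose n + 1) - (2n choose n + 2)\<close> from
  \<open>n\<close> to \<open>n + 1\<close>, and the subtracted term is the one that the sum gains.\<close>
lemma Catalan_plus_sum:
  assumes "0 < n"
  shows "int (2 * n choose n) - int (2 * n choose Suc n) + int (\<Sum>j<n. 2 * j choose Suc (Suc j)) =
    1 + int (\<Sum>i=1..n-1. (2 * i) choose (i - 1))"
  using assms
proof (induction n rule: nat_induct_non_zero)
  case (Suc n)
  obtain m where n: "n = Suc m" using Suc.hyps by (cases n) auto
  have "2 * n choose (n - 1) = 2 * n choose Suc n"
    using binomial_symmetric[of "n - 1" "2 * n"] n by simp
  then show ?case using Suc.IH by (simp add: n)
qed (simp add: numeral_2_eq_2)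

lemma card_inv_avoiding:
  assumes "0 < n"
  shows "card (inv_avoiding n {[1, 1, 0], [1, 0, 2]}) = 1 + (\<Sum>i=1..n-1. (2 * i) choose (i - 1))"
proof -
  have "inv_avoiding n {[1, 1, 0], [1, 0, 2]} = sorted_invseqs n \<union> unsorted_avoiders n"
    by (auto simp: inv_avoiding_iff[simplified] sorted_invseqs_def unsorted_avoiders_def avoider_if_sorted)
  then have "card (inv_avoiding n {[1, 1, 0], [1, 0, 2]}) =
      card (sorted_invseqs n) + card (unsorted_avoiders n)"
    by (auto simp: sorted_invseqs_def unsorted_avoiders_def intro!: card_Un_disjoint
          finite_subset[OF _ finite_inversion_sequences[of n]])
  then have "int (card (inv_avoiding n {[1, 1, 0], [1, 0, 2]})) =
      int (1 + (\<Sum>i=1..n-1. (2 * i) choose (i - 1)))"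
    using card_sorted_invseqs[OF assms] Catalan_plus_sum[OF assms]
    by (simp only: card_unsorted_avoiders of_nat_add of_nat_1)
  then show ?thesis by (simp only: of_nat_eq_iff)
qed

section \<open>Splitting by the position of the maximum\<close>

lemma max_pos_props:
  assumes "e \<noteq> []"
  shows "max_pos e < length e" "e ! max_pos e = Max (set e)" "\<And>i. i < max_pos e \<Longrightarrow> e ! i \<noteq> Max (set e)"
proof -
  have "Max (set e) \<in> set e" using assms by simp
  then have "dropWhile (\<lambda>x. x \<noteq> Max (set e)) e \<noteq> []" by (auto simp: dropWhile_eq_Nil_conv)
  then show less: "max_pos e < length e"
    unfolding max_pos_def
    by (metis length_append length_greater_0_conv less_add_same_cancel1 takeWhile_dropWhile_id)
  then show "e ! max_pos e = Max (set e)"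
    unfolding max_pos_def using nth_length_takeWhile by blast
  show "e ! i \<noteq> Max (set e)" if i: "i < max_pos e" for i
  proof -
    have "takeWhile (\<lambda>x. x \<noteq> Max (set e)) e ! i \<in> set (takeWhile (\<lambda>x. x \<noteq> Max (set e)) e)"
      using i unfolding max_pos_def by (rule nth_mem)
    then show ?thesis
      using takeWhile_nth[of i "\<lambda>x. x \<noteq> Max (set e)" e] i set_takeWhileD
      unfolding max_pos_def by fastforce
  qed
qed

lemma leftmost_occurrence_Max:
  assumes "e \<noteq> []"
  shows "leftmost_occurrence e (Max (set e)) l \<longleftrightarrow> l = Suc (max_pos e)"
proof
  assume l: "leftmost_occurrence e (Max (set e)) l"
  then have "e ! (l - 1) = Max (set e)" "1 \<le> l" "\<And>k. 1 \<le> k \<Longrightarrow> k < l \<Longrightarrow> e ! (k - 1) \<noteq> Max (set e)"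
    by (auto simp: leftmost_occurrence_def)
  from this(1,2) this(3)[of "Suc (max_pos e)"] max_pos_props(2)[OF assms]
    max_pos_props(3)[OF assms, of "l - 1"]
  show "l = Suc (max_pos e)" by fastforce
next
  assume "l = Suc (max_pos e)"
  then show "leftmost_occurrence e (Max (set e)) l"
    using max_pos_props[OF assms] by (auto simp: leftmost_occurrence_def)
qed

text \<open>The summand 1 is the zero sequence, the only one whose maximum is 0. A maximum \<open>m \<ge> 1\<close>
  first occurs at a position \<open>l\<close> with \<open>m \<le> l - 1\<close>, so all the others lie in the range of
  summation.\<close>
lemma card_inv_avoiding_conv_a_coeff:
  assumes "0 < n"
  shows "card (inv_avoiding n {[1, 1, 0], [1, 0, 2]}) = 1 + (\<Sum>l=2..n. \<Sum>m=1..l-1. a_coeff n m l)"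
proof -
  define I where "I = inv_avoiding n {[1, 1, 0 :: nat], [1, 0, 2]}"
  define C where "C t = {e \<in> I. Max (set e) = snd t \<and> leftmost_occurrence e (snd t) (fst t)}"
    for t :: "nat \<times> nat"
  define T where "T = (SIGMA l:{2..n}. {1..l - 1 :: nat})"
  have I: "e \<in> I \<longleftrightarrow> inversion_sequence n e \<and> avoider e" for e
    unfolding I_def by (rule inv_avoiding_iff)
  have nonempty: "e \<noteq> []" if "e \<in> I" for e
    using that assms by (auto simp: I inversion_sequence_def)
  have fin: "finite I"
    by (rule finite_subset[OF _ finite_inversion_sequences[of n]]) (auto simp: I)
  have zero: "replicate n 0 \<in> I"
    unfolding I by (simp add: avoider_if_sorted inversion_sequence_def)
  have "I - {replicate n 0} = (\<Union>t\<in>T. C t)"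
  proof (intro equalityI subsetI)
    fix e assume e: "e \<in> I - {replicate n 0}"
    then have inv: "inversion_sequence n e" and len: "length e = n" and ne: "e \<noteq> []"
      using nonempty by (auto simp: I inversion_sequence_def)
    have "Max (set e) \<noteq> 0"
    proof
      assume "Max (set e) = 0"
      then have "x = 0" if "x \<in> set e" for x using Max_ge[OF finite_set that] by simp
      then have "e = replicate n 0" using len by (metis replicate_eqI)
      then show False using e by simp
    qed
    moreover have "Max (set e) \<le> max_pos e" "max_pos e < n"
      using max_pos_props(1,2)[OF ne] inv len by (auto simp: inversion_sequence_def dest: spec)
    ultimately have "(Suc (max_pos e), Max (set e)) \<in> T" by (auto simp: T_def)
    moreover have "e \<in> C (Suc (max_pos e), Max (set e))"
      using e leftmost_occurrence_Max[OF ne] by (simp add: C_def)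
    ultimately show "e \<in> (\<Union>t\<in>T. C t)" by blast
  next
    fix e assume "e \<in> (\<Union>t\<in>T. C t)"
    then have "e \<in> I" "1 \<le> Max (set e)" by (auto simp: C_def T_def)
    moreover have "Max (set (replicate n (0 :: nat))) = 0" using assms by simp
    ultimately show "e \<in> I - {replicate n 0}" by fastforce
  qed
  then have "card (I - {replicate n 0}) = (\<Sum>t\<in>T. card (C t))"
  proof (simp only:, intro card_UN_disjoint ballI impI)
    fix t u :: "nat \<times> nat" assume "t \<noteq> u"
    show "C t \<inter> C u = {}"
    proof (rule ccontr)
      assume "C t \<inter> C u \<noteq> {}"
      then obtain e where "e \<in> C t" "e \<in> C u" by blast
      then have "e \<in> I" "snd t = Max (set e)" "snd u = Max (set e)"
        "leftmost_occurrence e (Max (set e)) (fst t)" "leftmost_occurrence e (Max (set e)) (fst u)"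
        by (simp_all add: C_def)
      then have "t = u"
        using leftmost_occurrence_Max[OF nonempty, of e] by (simp add: prod_eq_iff)
      then show False using \<open>t \<noteq> u\<close> by simp
    qed
  qed (auto simp: T_def C_def fin)
  also have "\<dots> = (\<Sum>l=2..n. \<Sum>m=1..l-1. a_coeff n m l)"
    unfolding T_def by (subst sum.Sigma) (auto simp: C_def I_def a_coeff_def intro!: sum.cong)
  finally have "card I = 1 + (\<Sum>l=2..n. \<Sum>m=1..l-1. a_coeff n m l)"
    using card_Suc_Diff1[OF fin zero] by simp
  then show ?thesis by (simp only: I_def)
qed

section \<open>The generating function\<close>

definition central_binomial_series :: "real fps" where
  "central_binomial_series = Abs_fps (\<lambda>n. of_nat (2 * n choose n))"

lemma Suc_times_binomial_central:
  "Suc n * (2 * Suc n choose Suc n) = 2 * (2 * n + 1) * (2 * n choose n)"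
proof -
  have "Suc n * (Suc (Suc (2 * n)) choose Suc n) = Suc (Suc (2 * n)) * (Suc (2 * n) choose n)"
    by (rule Suc_times_binomial)
  moreover have "Suc n * (Suc (2 * n) choose n) = Suc (2 * n) * (2 * n choose n)"
    using Suc_times_binomial[of n "2 * n"] binomial_symmetric[of n "Suc (2 * n)"] by simp
  ultimately have "Suc n * (Suc n * (Suc (Suc (2 * n)) choose Suc n)) =
      Suc (Suc (2 * n)) * (Suc (2 * n) * (2 * n choose n))"
    by (metis mult.left_commute)
  also have "\<dots> = Suc n * (2 * (2 * n + 1) * (2 * n choose n))"
    by (simp add: algebra_simps)
  finally have "Suc n * (Suc (Suc (2 * n)) choose Suc n) = 2 * (2 * n + 1) * (2 * n choose n)"
    by (simp only: mult_cancel1 nat.distinct simp_thms)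
  then show ?thesis by simp
qed

text \<open>The differential equation of \<open>(1 - 4x) powr (- 1/2)\<close>, read off the ratio of consecutive
  coefficients.\<close>
lemma central_binomial_ode:
  "(1 - 4 * fps_X) * fps_deriv central_binomial_series = 2 * central_binomial_series"
proof (rule fps_ext)
  fix n
  show "fps_nth ((1 - 4 * fps_X) * fps_deriv central_binomial_series) n =
      fps_nth (2 * central_binomial_series) n"
  proof (cases n)
    case 0
    then show ?thesis by (simp add: central_binomial_series_def algebra_simps numeral_fps_const)
  next
    case (Suc m)
    have "real (Suc n) * real (2 * Suc n choose Suc n) = 2 * (2 * real n + 1) * real (2 * n choose n)"
      using arg_cong[OF Suc_times_binomial_central[of n], of real] unfolding of_nat_mult by simp
    then show ?thesis
      unfolding central_binomial_series_def left_diff_distrib mult.assoc numeral_fps_const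
      by (simp add: Suc algebra_simps del: binomial_Suc_Suc mult_Suc_right)
  qed
qed

text \<open>The logarithmic derivatives of the two factors cancel, so the product is constant.\<close>
lemma sqrt_times_central: "sqrt_1_minus_4x * central_binomial_series = 1"
proof -
  let ?s = sqrt_1_minus_4x and ?c = central_binomial_series
  have "fps_deriv (?s ^ 2) = fps_deriv (1 - 4 * fps_X)"
    by (simp only: sqrt_1_minus_4x_square)
  then have ds: "2 * (?s * fps_deriv ?s) = - 4"
    by (simp add: power2_eq_square numeral_fps_const algebra_simps)
  have "2 * ((1 - 4 * fps_X) * fps_deriv (?s * ?c)) =
      ?s * ?s * (2 * (?s * fps_deriv ?c)) + ?s * ?c * (2 * (?s * fps_deriv ?s))"
    unfolding sqrt_1_minus_4x_square[symmetric] by (simp add: power2_eq_square algebra_simps)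
  also have "\<dots> = 2 * ?s * ((1 - 4 * fps_X) * fps_deriv ?c) - 4 * ?s * ?c"
    unfolding ds sqrt_1_minus_4x_square[symmetric] by (simp add: power2_eq_square algebra_simps)
  also have "\<dots> = 0" unfolding central_binomial_ode by (simp add: algebra_simps)
  finally have "2 * ((1 - 4 * fps_X) * fps_deriv (?s * ?c)) = 0" .
  moreover have "fps_nth (1 - 4 * fps_X :: real fps) 0 \<noteq> 0" by simp
  then have "(1 - 4 * fps_X :: real fps) \<noteq> 0" by (metis fps_zero_nth)
  ultimately have "fps_deriv (?s * ?c) = 0" by simp
  then have "?s * ?c = fps_const (fps_nth (?s * ?c) 0)"
    by (rule iffD1[OF fps_deriv_eq_0_iff])
  also have "fps_nth (?s * ?c) 0 = 1"
    by (simp add: sqrt_1_minus_4x_nth_0 central_binomial_series_def)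
  finally show ?thesis by simp
qed

text \<open>The coefficients are the differences of consecutive values of the cardinality; the case distinction
  is needed because \<open>0 choose (0 - 1)\<close> is 1 with truncated subtraction.\<close>
definition increment_series :: "real fps" where
  "increment_series = Abs_fps (\<lambda>i. if i = 0 then 0 else of_nat (2 * i choose (i - 1)))"

lemma increment_series_conv_central:
  "2 * fps_X * increment_series = (1 - 2 * fps_X) * central_binomial_series - 1"
proof (rule fps_ext)
  fix n
  show "fps_nth (2 * fps_X * increment_series) n =
      fps_nth ((1 - 2 * fps_X) * central_binomial_series - 1) n"
  proof (cases n)
    case 0
    then show ?thesis
      by (simp add: central_binomial_series_def mult.assoc left_diff_distrib numeral_fps_const)
  next
    case (Suc m)
    have "real (2 * Suc m choose Suc m) = 2 * real (2 * m choose m) + 2 * fps_nth increment_series m"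
    proof (cases m)
      case 0
      then show ?thesis by (simp add: increment_series_def)
    next
      case (Suc k)
      have "2 * m choose k = 2 * m choose Suc m"
        using binomial_symmetric[of k "2 * m"] Suc by simp
      then show ?thesis by (simp add: increment_series_def Suc)
    qed
    then show ?thesis
      by (simp add: central_binomial_series_def Suc mult.assoc left_diff_distrib
          numeral_fps_const del: mult_Suc_right)
  qed
qed

definition total_series :: "real fps" where
  "total_series = Abs_fps (\<lambda>n. \<Sum>i=1..n-1. of_nat (2 * i choose (i - 1)))"

lemma total_series_conv_increment:
  "(1 - fps_X) * total_series = fps_X * increment_series"
proof (rule fps_ext)
  fix n
  show "fps_nth ((1 - fps_X) * total_series) n = fps_nth (fps_X * increment_series) n"
  proof (cases n)
    case (Suc m)
    then show ?thesis
      by (cases m) (simp_all add: total_series_def increment_series_def left_diff_distrib)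
  qed (simp add: total_series_def left_diff_distrib)
qed

text \<open>Write \<open>s\<close> for the square root and \<open>c = 1 / s\<close>. By the
  preceding lemmas, \<open>(1 - x) * total_series = ((1 - 2x) c - 1) / 2\<close>. Moreover
  \<open>-4x^2 + 5x - 1 = - s^2 (1 - x)\<close>, so the second factor of the denominator is divisible by
  \<open>s\<close>, and \<open>s c = 1\<close> removes \<open>c\<close>.\<close>
lemma total_series_closed_form:
  "total_series = (fps_X ^ 2 + fps_X ^ 2 * sqrt_1_minus_4x) /
    ((fps_X - 1) * ((3 * fps_X - 1) * sqrt_1_minus_4x - 4 * fps_X ^ 2 + 5 * fps_X - 1))"
  (is "total_series = ?N / ?D")
proof -
  let ?s = sqrt_1_minus_4x
  have s2: "?s * ?s = 1 - 4 * fps_X" using sqrt_1_minus_4x_square by (simp add: power2_eq_square)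
  have "2 * (total_series * ?D) =
      - (2 * ((1 - fps_X) * total_series)) * ((3 * fps_X - 1) * ?s - 4 * fps_X ^ 2 + 5 * fps_X - 1)"
    by (simp add: algebra_simps)
  also have "\<dots> =
      - (2 * fps_X * increment_series) * ((3 * fps_X - 1) * ?s + (1 - fps_X) * (4 * fps_X - 1))"
    unfolding total_series_conv_increment by (simp add: algebra_simps power2_eq_square)
  also have "\<dots> =
      - ((1 - 2 * fps_X) * central_binomial_series - 1) * ((3 * fps_X - 1) * ?s - (1 - fps_X) * (?s * ?s))"
    unfolding increment_series_conv_central s2 by (simp add: algebra_simps)
  also have "\<dots> =
      - ((1 - 2 * fps_X) * (?s * central_binomial_series) - ?s) * ((3 * fps_X - 1) - (1 - fps_X) * ?s)"
    by (simp add: algebra_simps)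
  also have "\<dots> = (1 - 2 * fps_X) * (1 - 3 * fps_X) + (2 * fps_X ^ 2) * ?s
      - (1 - fps_X) * (?s * ?s)"
    unfolding sqrt_times_central by (simp add: algebra_simps power2_eq_square)
  also have "\<dots> = 2 * ?N"
    unfolding s2 by (simp add: algebra_simps power2_eq_square)
  finally have "total_series * ?D = ?N" by (metis mult_cancel_left zero_neq_numeral)
  moreover have "?D \<noteq> 0" by (metis denominator_nth_0 fps_zero_nth zero_neq_numeral)
  ultimately show ?thesis by (metis nonzero_mult_div_cancel_right)
qed

theorem theorem4p7:
  shows "(a_series 1 1 :: real fps) =
           (fps_X ^ 2 + fps_X ^ 2 * sqrt_1_minus_4x) /
           ((fps_X - 1) *
             ((3 * fps_X - 1) * sqrt_1_minus_4x - 4 * fps_X ^ 2 + 5 * fps_X - 1))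
       \<and> (\<forall>n\<ge>1. card (inv_avoiding n {[1,1,0], [1,0,2]}) =
              1 + (\<Sum>i=1..n-1. (2 * i) choose (i - 1)))"
proof (intro conjI allI impI)
  have "fps_nth (a_series 1 1 :: real fps) n = fps_nth total_series n" for n
  proof (cases "n = 0")
    case True
    then show ?thesis by (simp add: a_series_def total_series_def)
  next
    case False
    have "fps_nth (a_series 1 1 :: real fps) n = real (\<Sum>l=2..n. \<Sum>m=1..l-1. a_coeff n m l)"
      by (simp add: a_series_def)
    also have "(\<Sum>l=2..n. \<Sum>m=1..l-1. a_coeff n m l) = (\<Sum>i=1..n-1. (2 * i) choose (i - 1))"
      using card_inv_avoiding_conv_a_coeff[of n] card_inv_avoiding[of n] False by linarith
    finally show ?thesis by (simp add: total_series_def)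
  qed
  then have "(a_series 1 1 :: real fps) = total_series" by (simp add: fps_eq_iff)
  then show "(a_series 1 1 :: real fps) =
           (fps_X ^ 2 + fps_X ^ 2 * sqrt_1_minus_4x) /
           ((fps_X - 1) *
             ((3 * fps_X - 1) * sqrt_1_minus_4x - 4 * fps_X ^ 2 + 5 * fps_X - 1))"
    by (simp only: total_series_closed_form)
next
  fix n :: nat
  assume "1 \<le> n"
  then show "card (inv_avoiding n {[1,1,0], [1,0,2]}) = 1 + (\<Sum>i=1..n-1. (2 * i) choose (i - 1))"
    by (intro card_inv_avoiding) simp
qed

end
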